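(* Let $CC$ be a C-system and let $\mathbf{\Pi}:Ob_{\ge2}\to Ob$ be a function such that for every $B\in Ob_{\ge 2}$, with $\Gamma=ft^2(B)$, one has $ft(\mathbf{\Pi}(B))=\Gamma$ and $f^*(\mathbf{\Pi}(B))=\mathbf{\Pi}(f^*(B))$ for all $f:\Gamma'\to\Gamma$. There is a bijection between the sets $AllAp_2^{\mathbf{\Pi}}$ and $AllAp_1^{\mathbf{\Pi}}$. Explicitly, the function $AllAp_2^{\mathbf{\Pi}}\to AllAp_1^{\mathbf{\Pi}}$ sending a family $Ap_*$ to the family $B\mapsto exch(A,\mathbf{\Pi}(B);\Gamma)\circ Ap_B$ and the function $AllAp_1^{\mathbf{\Pi}}\to AllAp_2^{\mathbf{\Pi}}$ sending a family $Ap_*$ to the family $B\mapsto exch(\mathbf{\Pi}(B),A;\Gamma)\circ Ap_B$ (where $A=ft(B)$, $\Gamma=ft^2(B)$) are well defined and mutually inverse.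
   Context: Composition is written in diagrammatic order: for $f:X\to Y$, $g:Y\to Z$, the composite is $f\circ g:X\to Z$. A C-system $CC$ consists of a category with set of objects $Ob$ and set of morphisms $Mor$, functions $l:Ob\to\mathbb{N}$ and $ft:Ob\to Ob$, an object $pt$, for each $X$ a morphism $p_X:X\to ft(X)$, and for each $X$ with $l(X)>0$ and each $f:Y\to ft(X)$ an object $f^*(X)$ and a morphism $q(f,X):f^*(X)\to X$, such that: $l^{-1}(0)=\{pt\}$; $l(ft(X))=l(X)-1$ if $l(X)>0$; $ft(pt)=pt$; $pt$ is a final object; if $l(X)>0$ and $f:Y\to ft(X)$, then $l(f^*(X))>0$, $ft(f^*(X))=Y$, $p_{f^*(X)}\circ f=q(f,X)\circ p_X$ and this square is a pullback; $Id_{ft(X)}^*(X)=X$ and $q(Id_{ft(X)},X)=Id_X$; for $g:Z\to Y$ and $f:Y\to ft(X)$, $(g\circ f)^*(X)=g^*(f^*(X))$ and $q(g\circ f,X)=q(g,f^*(X))\circ q(f,X)$. $X\ge Y$ ("$X$ is over $Y$") means $l(X)\ge l(Y)$ and $Y=ft^{l(X)-l(Y)}(X)$; $X>Y$ means $X\ge Y$ and $l(X)>l(Y)$. For $X\ge Y$, $p(X,Y):X\to Y$ is defined by $p(X,X)=Id_X$, $p(X,Y)=p_X\circ p(ft(X),Y)$ if $X>Y$. For $X\ge\Gamma$ and $f:\Gamma'\to\Gamma$, $f^*(X)$ and $q(f,X):f^*(X)\to X$ are defined recursively by $f^*(\Gamma)=\Gamma'$, $q(f,\Gamma)=f$, and,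 for $X>\Gamma$, $f^*(X)=q(f,ft(X))^*(X)$, $q(f,X)=q(q(f,ft(X)),X)$. For $X,Y\ge\Gamma$, $X\times_{\Gamma}Y=p(X,\Gamma)^*(Y)$ (a fiber product with projections $p(X\times_\Gamma Y,X)$ and $q(p(X,\Gamma),Y)$), and $exch(X,Y;\Gamma):X\times_{\Gamma}Y\to Y\times_{\Gamma}X$ is the unique morphism with $exch(X,Y;\Gamma)\circ q(p(Y,\Gamma),X)=p(X\times_{\Gamma}Y,X)$ and $exch(X,Y;\Gamma)\circ p(Y\times_{\Gamma}X,Y)=q(p(X,\Gamma),Y)$. A morphism $a:X\to Y$ is a morphism over $\Gamma$ if $X,Y\ge\Gamma$ and $a\circ p(Y,\Gamma)=p(X,\Gamma)$. For such $a$ and $f:\Gamma'\to\Gamma$, $f^*(a):f^*(X)\to f^*(Y)$ is the unique morphism over $\Gamma'$ with $f^*(a)\circ q(f,Y)=q(f,X)\circ a$. For $p:X\to Y$, $sec(p)=\{s:Y\to X\mid s\circ p=Id_Y\}$. $\widetilde{\mathcal{O}b}=\{o\in Mor\mid o\in sec(p_{codom(o)}),\ codom(o)>pt\}$ and $\partial:\widetilde{\mathcal{O}b}\to Ob$, $\partial(o)=codom(o)$. $Ob_{\ge 2}=\{B\mid l(B)\ge2\}$; for $B\in Ob_{\ge2}$ write $A=ft(B)$, $\Gamma=ft^2(B)$. $AllAp_1^{\mathbf{\Pi}}$ is the set of families of morphisms $Ap_B:A\times_{\Gamma}\mathbf{\Pi}(B)\to B$ parametrized by $B\in Ob_{\ge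 2}$ such that: (a) $Ap_B$ is a morphism over $A$; (b) $f^*(Ap_B)=Ap_{f^*(B)}$ for every $f:\Gamma'\to\Gamma$; (c) the function $\partial^{-1}(\mathbf{\Pi}(B))\to\partial^{-1}(B)$, $s\mapsto p_A^*(s)\circ Ap_B$, is a bijection. $AllAp_2^{\mathbf{\Pi}}$ is the set of families of morphisms $Ap_B:\mathbf{\Pi}(B)\times_{\Gamma}A\to B$ parametrized by $B\in Ob_{\ge2}$ such that: (a) $Ap_B\circ p_B=q(p_{\mathbf{\Pi}(B)},A)$; (b) $f^*(Ap_B)=Ap_{f^*(B)}$ for every $f:\Gamma'\to\Gamma$; (c) the function $\partial^{-1}(\mathbf{\Pi}(B))\to\partial^{-1}(B)$, $s\mapsto q(s,\mathbf{\Pi}(B)\times_{\Gamma}A)\circ Ap_B$, is a bijection. (In both cases (a) implies that $Ap_B$ is a morphism over $\Gamma$.) *)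

theory Defs
  imports "HOL-Library.FuncSet"
begin

text \<open>
  Composition is written in diagrammatic order: \<open>f \<odot> g\<close> is \<open>f\<close> followed by \<open>g\<close>.
  The operations are total HOL functions; their values are only constrained (and only used) on
  the domains that occur in the axioms below.  In particular \<open>pb f X\<close> and \<open>q f X\<close>, the object
  \<open>f\<^sup>*(X)\<close> and the morphism \<open>q(f,X)\<close>, are meaningful when \<open>len X > 0\<close> and \<open>f\<close> has codomain \<open>ft X\<close>.
\<close>

record ('o, 'm) csystem =
  Ob :: "'o set"  ("Ob\<index>")
  Mor :: "'m set"  ("Mor\<index>")
  Dom :: "'m \<Rightarrow> 'o"  ("Dom\<index>")
  Cod :: "'m \<Rightarrow> 'o"  ("Cod\<index>")
  idm :: "'o \<Rightarrow> 'm"  ("idm\<index>")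
  cmp :: "'m \<Rightarrow> 'm \<Rightarrow> 'm"  (infixl "\<odot>\<index>" 70)
  len :: "'o \<Rightarrow> nat"  ("len\<index>")
  ft :: "'o \<Rightarrow> 'o"  ("ft\<index>")
  pt :: "'o"  ("pt\<index>")
  pr :: "'o \<Rightarrow> 'm"  ("pr\<index>")
  pb :: "'m \<Rightarrow> 'o \<Rightarrow> 'o"  ("pb\<index>")
  q :: "'m \<Rightarrow> 'o \<Rightarrow> 'm"  ("q\<index>")

definition Hom :: "('o, 'm) csystem \<Rightarrow> 'o \<Rightarrow> 'o \<Rightarrow> 'm set"  ("Hom\<index>") where
  "Hom\<^bsub>C\<^esub> X Y = {f \<in> Mor\<^bsub>C\<^esub>. Dom\<^bsub>C\<^esub> f = X \<and> Cod\<^bsub>C\<^esub> f = Y}"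

text \<open>\<open>is_pullback C a b f g\<close>: the square \<open>a \<odot> f = b \<odot> g\<close> commutes and is cartesian.\<close>

definition is_pullback :: "('o, 'm) csystem \<Rightarrow> 'm \<Rightarrow> 'm \<Rightarrow> 'm \<Rightarrow> 'm \<Rightarrow> bool" where
  "is_pullback C a b f g \<longleftrightarrow>
     a \<in> Mor\<^bsub>C\<^esub> \<and> b \<in> Mor\<^bsub>C\<^esub> \<and> f \<in> Mor\<^bsub>C\<^esub> \<and> g \<in> Mor\<^bsub>C\<^esub> \<and>
     Dom\<^bsub>C\<^esub> a = Dom\<^bsub>C\<^esub> b \<and> Cod\<^bsub>C\<^esub> a = Dom\<^bsub>C\<^esub> f \<and> Cod\<^bsub>C\<^esub> b = Dom\<^bsub>C\<^esub> g \<and> Cod\<^bsub>C\<^esub> f = Cod\<^bsub>C\<^esub> g \<and>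
     a \<odot>\<^bsub>C\<^esub> f = b \<odot>\<^bsub>C\<^esub> g \<and>
     (\<forall>Z \<in> Ob\<^bsub>C\<^esub>. \<forall>u \<in> Hom\<^bsub>C\<^esub> Z (Dom\<^bsub>C\<^esub> f). \<forall>v \<in> Hom\<^bsub>C\<^esub> Z (Dom\<^bsub>C\<^esub> g). u \<odot>\<^bsub>C\<^esub> f = v \<odot>\<^bsub>C\<^esub> g \<longrightarrow>
        (\<exists>!w. w \<in> Hom\<^bsub>C\<^esub> Z (Dom\<^bsub>C\<^esub> a) \<and> w \<odot>\<^bsub>C\<^esub> a = u \<and> w \<odot>\<^bsub>C\<^esub> b = v))"

locale c_system =
  fixes CC :: "('o, 'm) csystem"  (structure)
  assumes Dom_Ob: "f \<in> Mor \<Longrightarrow> Dom f \<in> Ob"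
    and Cod_Ob: "f \<in> Mor \<Longrightarrow> Cod f \<in> Ob"
    and idm_Hom: "X \<in> Ob \<Longrightarrow> idm X \<in> Hom X X"
    and cmp_Hom: "\<lbrakk>f \<in> Hom X Y; g \<in> Hom Y Z\<rbrakk> \<Longrightarrow> f \<odot> g \<in> Hom X Z"
    and idm_left: "f \<in> Hom X Y \<Longrightarrow> idm X \<odot> f = f"
    and idm_right: "f \<in> Hom X Y \<Longrightarrow> f \<odot> idm Y = f"
    and cmp_assoc: "\<lbrakk>f \<in> Hom X Y; g \<in> Hom Y Z; h \<in> Hom Z W\<rbrakk> \<Longrightarrow> (f \<odot> g) \<odot> h = f \<odot> (g \<odot> h)"
    and ft_Ob: "X \<in> Ob \<Longrightarrow> ft X \<in> Ob"
    and pr_Hom: "X \<in> Ob \<Longrightarrow> pr X \<in> Hom X (ft X)"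
    and pb_Ob: "\<lbrakk>X \<in> Ob; len X > 0; f \<in> Hom Y (ft X)\<rbrakk> \<Longrightarrow> pb f X \<in> Ob"
    and q_Hom: "\<lbrakk>X \<in> Ob; len X > 0; f \<in> Hom Y (ft X)\<rbrakk> \<Longrightarrow> q f X \<in> Hom (pb f X) X"
    and len_zero: "{X \<in> Ob. len X = 0} = {pt}"
    and len_ft: "\<lbrakk>X \<in> Ob; len X > 0\<rbrakk> \<Longrightarrow> len (ft X) = len X - 1"
    and ft_pt: "ft pt = pt"
    and pt_final: "X \<in> Ob \<Longrightarrow> \<exists>!f. f \<in> Hom X pt"
    and len_pb: "\<lbrakk>X \<in> Ob; len X > 0; f \<in> Hom Y (ft X)\<rbrakk> \<Longrightarrow> len (pb f X) > 0"
    and ft_pb: "\<lbrakk>X \<in> Ob; len X > 0; f \<in> Hom Y (ft X)\<rbrakk> \<Longrightarrow> ft (pb f X) = Y"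
    and square_pullback: "\<lbrakk>X \<in> Ob; len X > 0; f \<in> Hom Y (ft X)\<rbrakk> \<Longrightarrow>
      is_pullback CC (pr (pb f X)) (q f X) f (pr X)"
    and pb_idm: "\<lbrakk>X \<in> Ob; len X > 0\<rbrakk> \<Longrightarrow> pb (idm (ft X)) X = X"
    and q_idm: "\<lbrakk>X \<in> Ob; len X > 0\<rbrakk> \<Longrightarrow> q (idm (ft X)) X = idm X"
    and pb_cmp: "\<lbrakk>X \<in> Ob; len X > 0; g \<in> Hom Z Y; f \<in> Hom Y (ft X)\<rbrakk> \<Longrightarrow>
      pb (g \<odot> f) X = pb g (pb f X)"
    and q_cmp: "\<lbrakk>X \<in> Ob; len X > 0; g \<in> Hom Z Y; f \<in> Hom Y (ft X)\<rbrakk> \<Longrightarrow>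
      q (g \<odot> f) X = q g (pb f X) \<odot> q f X"

definition over :: "('o, 'm) csystem \<Rightarrow> 'o \<Rightarrow> 'o \<Rightarrow> bool" where
  "over C X Y \<longleftrightarrow> X \<in> Ob\<^bsub>C\<^esub> \<and> Y \<in> Ob\<^bsub>C\<^esub> \<and> len\<^bsub>C\<^esub> Y \<le> len\<^bsub>C\<^esub> X \<and> Y = (ft\<^bsub>C\<^esub> ^^ (len\<^bsub>C\<^esub> X - len\<^bsub>C\<^esub> Y)) X"

definition strictly_over :: "('o, 'm) csystem \<Rightarrow> 'o \<Rightarrow> 'o \<Rightarrow> bool" where
  "strictly_over C X Y \<longleftrightarrow> over C X Y \<and> len\<^bsub>C\<^esub> Y < len\<^bsub>C\<^esub> X"

text \<open>
  The recursions defining \<open>p(X,\<Gamma>)\<close>, \<open>f\<^sup>*(X)\<close> and \<open>q(f,X)\<close> for \<open>X \<ge> \<Gamma>\<close> are run on the number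
  \<open>l(X) - l(\<Gamma>)\<close> of steps from \<open>X\<close> down to \<open>\<Gamma>\<close>; the base object \<open>\<Gamma>\<close> of \<open>f\<^sup>*\<close> is the codomain
  of \<open>f\<close>.  The lemmas at the end of this theory recover the recursive equations.
\<close>

primrec pr_iter :: "('o, 'm) csystem \<Rightarrow> nat \<Rightarrow> 'o \<Rightarrow> 'm" where
  "pr_iter C 0 X = idm\<^bsub>C\<^esub> X"
| "pr_iter C (Suc n) X = pr\<^bsub>C\<^esub> X \<odot>\<^bsub>C\<^esub> pr_iter C n (ft\<^bsub>C\<^esub> X)"

definition pr_to :: "('o, 'm) csystem \<Rightarrow> 'o \<Rightarrow> 'o \<Rightarrow> 'm" where
  "pr_to C X Y = pr_iter C (len\<^bsub>C\<^esub> X - len\<^bsub>C\<^esub> Y) X"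

primrec q_iter :: "('o, 'm) csystem \<Rightarrow> nat \<Rightarrow> 'm \<Rightarrow> 'o \<Rightarrow> 'm" where
  "q_iter C 0 f X = f"
| "q_iter C (Suc n) f X = q\<^bsub>C\<^esub> (q_iter C n f (ft\<^bsub>C\<^esub> X)) X"

primrec pb_iter :: "('o, 'm) csystem \<Rightarrow> nat \<Rightarrow> 'm \<Rightarrow> 'o \<Rightarrow> 'o" where
  "pb_iter C 0 f X = Dom\<^bsub>C\<^esub> f"
| "pb_iter C (Suc n) f X = pb\<^bsub>C\<^esub> (q_iter C n f (ft\<^bsub>C\<^esub> X)) X"

definition q_ext :: "('o, 'm) csystem \<Rightarrow> 'm \<Rightarrow> 'o \<Rightarrow> 'm" where
  "q_ext C f X = q_iter C (len\<^bsub>C\<^esub> X - len\<^bsub>C\<^esub> (Cod\<^bsub>C\<^esub> f)) f X"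

definition pb_ext :: "('o, 'm) csystem \<Rightarrow> 'm \<Rightarrow> 'o \<Rightarrow> 'o" where
  "pb_ext C f X = pb_iter C (len\<^bsub>C\<^esub> X - len\<^bsub>C\<^esub> (Cod\<^bsub>C\<^esub> f)) f X"

text \<open>\<open>fprod C X Y \<Gamma>\<close> is \<open>X \<times>\<^sub>\<Gamma> Y\<close>.\<close>

definition fprod :: "('o, 'm) csystem \<Rightarrow> 'o \<Rightarrow> 'o \<Rightarrow> 'o \<Rightarrow> 'o" where
  "fprod C X Y \<Gamma> = pb_ext C (pr_to C X \<Gamma>) Y"

definition exch :: "('o, 'm) csystem \<Rightarrow> 'o \<Rightarrow> 'o \<Rightarrow> 'o \<Rightarrow> 'm" where
  "exch C X Y \<Gamma> = (THE e. e \<in> Hom\<^bsub>C\<^esub> (fprod C X Y \<Gamma>) (fprod C Y X \<Gamma>) \<and>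
     e \<odot>\<^bsub>C\<^esub> q_ext C (pr_to C Y \<Gamma>) X = pr_to C (fprod C X Y \<Gamma>) X \<and>
     e \<odot>\<^bsub>C\<^esub> pr_to C (fprod C Y X \<Gamma>) Y = q_ext C (pr_to C X \<Gamma>) Y)"

definition mor_over :: "('o, 'm) csystem \<Rightarrow> 'o \<Rightarrow> 'm \<Rightarrow> bool" where
  "mor_over C \<Gamma> a \<longleftrightarrow> a \<in> Mor\<^bsub>C\<^esub> \<and> over C (Dom\<^bsub>C\<^esub> a) \<Gamma> \<and> over C (Cod\<^bsub>C\<^esub> a) \<Gamma> \<and>
     a \<odot>\<^bsub>C\<^esub> pr_to C (Cod\<^bsub>C\<^esub> a) \<Gamma> = pr_to C (Dom\<^bsub>C\<^esub> a) \<Gamma>"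

text \<open>\<open>pb_mor C f a\<close> is \<open>f\<^sup>*(a)\<close>, for \<open>a\<close> a morphism over the codomain of \<open>f\<close>.\<close>

definition pb_mor :: "('o, 'm) csystem \<Rightarrow> 'm \<Rightarrow> 'm \<Rightarrow> 'm" where
  "pb_mor C f a = (THE b. b \<in> Hom\<^bsub>C\<^esub> (pb_ext C f (Dom\<^bsub>C\<^esub> a)) (pb_ext C f (Cod\<^bsub>C\<^esub> a)) \<and>
     mor_over C (Dom\<^bsub>C\<^esub> f) b \<and>
     b \<odot>\<^bsub>C\<^esub> q_ext C f (Cod\<^bsub>C\<^esub> a) = q_ext C f (Dom\<^bsub>C\<^esub> a) \<odot>\<^bsub>C\<^esub> a)"

definition sec :: "('o, 'm) csystem \<Rightarrow> 'm \<Rightarrow> 'm set" where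
  "sec C p = {s \<in> Hom\<^bsub>C\<^esub> (Cod\<^bsub>C\<^esub> p) (Dom\<^bsub>C\<^esub> p). s \<odot>\<^bsub>C\<^esub> p = idm\<^bsub>C\<^esub> (Cod\<^bsub>C\<^esub> p)}"

definition Ob_tilde :: "('o, 'm) csystem \<Rightarrow> 'm set" where
  "Ob_tilde C = {s \<in> Mor\<^bsub>C\<^esub>. s \<in> sec C (pr\<^bsub>C\<^esub> (Cod\<^bsub>C\<^esub> s)) \<and> strictly_over C (Cod\<^bsub>C\<^esub> s) pt\<^bsub>C\<^esub>}"

definition bdry :: "('o, 'm) csystem \<Rightarrow> 'm \<Rightarrow> 'o" where
  "bdry C s = Cod\<^bsub>C\<^esub> s"

definition bdry_fiber :: "('o, 'm) csystem \<Rightarrow> 'o \<Rightarrow> 'm set" where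
  "bdry_fiber C X = {s \<in> Ob_tilde C. bdry C s = X}"

definition Ob2 :: "('o, 'm) csystem \<Rightarrow> 'o set" where
  "Ob2 C = {B \<in> Ob\<^bsub>C\<^esub>. len\<^bsub>C\<^esub> B \<ge> 2}"

text \<open>
  Families indexed by \<open>Ob2 C\<close> are HOL functions that are \<open>undefined\<close> outside \<open>Ob2 C\<close>, so that
  equality of families is equality of functions.
\<close>

definition AllAp1 :: "('o, 'm) csystem \<Rightarrow> ('o \<Rightarrow> 'o) \<Rightarrow> ('o \<Rightarrow> 'm) set" where
  "AllAp1 C PiF = {Ap \<in> extensional (Ob2 C). \<forall>B \<in> Ob2 C.
     (let A = ft\<^bsub>C\<^esub> B; \<Gamma> = ft\<^bsub>C\<^esub> (ft\<^bsub>C\<^esub> B) in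
       Ap B \<in> Hom\<^bsub>C\<^esub> (fprod C A (PiF B) \<Gamma>) B \<and>
       mor_over C A (Ap B) \<and>
       (\<forall>\<Gamma>'. \<forall>f \<in> Hom\<^bsub>C\<^esub> \<Gamma>' \<Gamma>. pb_mor C f (Ap B) = Ap (pb_ext C f B)) \<and>
       bij_betw (\<lambda>s. pb_mor C (pr\<^bsub>C\<^esub> A) s \<odot>\<^bsub>C\<^esub> Ap B) (bdry_fiber C (PiF B)) (bdry_fiber C B))}"

definition AllAp2 :: "('o, 'm) csystem \<Rightarrow> ('o \<Rightarrow> 'o) \<Rightarrow> ('o \<Rightarrow> 'm) set" where
  "AllAp2 C PiF = {Ap \<in> extensional (Ob2 C). \<forall>B \<in> Ob2 C.
     (let A = ft\<^bsub>C\<^esub> B; \<Gamma> = ft\<^bsub>C\<^esub> (ft\<^bsub>C\<^esub> B) in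
       Ap B \<in> Hom\<^bsub>C\<^esub> (fprod C (PiF B) A \<Gamma>) B \<and>
       Ap B \<odot>\<^bsub>C\<^esub> pr\<^bsub>C\<^esub> B = q_ext C (pr\<^bsub>C\<^esub> (PiF B)) A \<and>
       (\<forall>\<Gamma>'. \<forall>f \<in> Hom\<^bsub>C\<^esub> \<Gamma>' \<Gamma>. pb_mor C f (Ap B) = Ap (pb_ext C f B)) \<and>
       bij_betw (\<lambda>s. q_ext C s (fprod C (PiF B) A \<Gamma>) \<odot>\<^bsub>C\<^esub> Ap B)
         (bdry_fiber C (PiF B)) (bdry_fiber C B))}"

definition Ap2_to_Ap1 :: "('o, 'm) csystem \<Rightarrow> ('o \<Rightarrow> 'o) \<Rightarrow> ('o \<Rightarrow> 'm) \<Rightarrow> ('o \<Rightarrow> 'm)" where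
  "Ap2_to_Ap1 C PiF Ap =
     (\<lambda>B \<in> Ob2 C. exch C (ft\<^bsub>C\<^esub> B) (PiF B) (ft\<^bsub>C\<^esub> (ft\<^bsub>C\<^esub> B)) \<odot>\<^bsub>C\<^esub> Ap B)"

definition Ap1_to_Ap2 :: "('o, 'm) csystem \<Rightarrow> ('o \<Rightarrow> 'o) \<Rightarrow> ('o \<Rightarrow> 'm) \<Rightarrow> ('o \<Rightarrow> 'm)" where
  "Ap1_to_Ap2 C PiF Ap =
     (\<lambda>B \<in> Ob2 C. exch C (PiF B) (ft\<^bsub>C\<^esub> B) (ft\<^bsub>C\<^esub> (ft\<^bsub>C\<^esub> B)) \<odot>\<^bsub>C\<^esub> Ap B)"

context c_system
begin

lemma pr_to_self: "pr_to CC X X = idm X"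
  by (simp add: pr_to_def)

lemma q_ext_self: "q_ext CC f (Cod f) = f"
  by (simp add: q_ext_def)

lemma pb_ext_self: "pb_ext CC f (Cod f) = Dom f"
  by (simp add: pb_ext_def)

lemma strictly_over_diff:
  assumes "strictly_over CC X Y"
  shows "len X - len Y = Suc (len (ft X) - len Y)"
  using assms len_ft[of X] by (auto simp: strictly_over_def over_def)

lemma pr_to_step: "strictly_over CC X Y \<Longrightarrow> pr_to CC X Y = pr X \<odot> pr_to CC (ft X) Y"
  by (simp add: pr_to_def strictly_over_diff)

lemma q_ext_step: "strictly_over CC X (Cod f) \<Longrightarrow> q_ext CC f X = q (q_ext CC f (ft X)) X"
  by (simp add: q_ext_def strictly_over_diff)

lemma pb_ext_step: "strictly_over CC X (Cod f) \<Longrightarrow> pb_ext CC f X = pb (q_ext CC f (ft X)) X"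
  by (simp add: pb_ext_def q_ext_def strictly_over_diff)

end

end

theory Submission
  imports Defs
begin

text \<open>
  Write \<open>A = ft B\<close>, \<open>\<Gamma> = ft A\<close> and \<open>P = PiF B\<close>.  The objects \<open>A \<times>\<^sub>\<Gamma> P\<close> and \<open>P \<times>\<^sub>\<Gamma> A\<close> are fiber
  products of the same two maps \<open>p\<^sub>A\<close> and \<open>p\<^sub>P\<close>, and the exchange maps are the mutually inverse
  isomorphisms between them (\<open>exch_exch\<close>).  Hence composing with them gives mutually inverse
  operations on families of morphisms, and the content of the theorem is that these operations
  carry each of the conditions (a), (b), (c) of one kind of family to that of the other.

  Condition (a): in both versions it says that \<open>Ap B\<close> followed by \<open>p\<^sub>B\<close> is the projection of the
  fiber product to \<open>A\<close>, and the exchange map respects the projections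
  (\<open>exch_mor_over_ft\<close>, \<open>exch_projection\<close>).

  Condition (b): base change along \<open>f\<close> is functorial (\<open>pb_mor_cmp\<close>) and, because \<open>f\<^sup>*(X \<times>\<^sub>\<Gamma> Y)\<close> is
  equal, and not merely isomorphic, to \<open>f\<^sup>*(X) \<times>\<^bsub>\<Gamma>'\<^esub> f\<^sup>*(Y)\<close>, compatibly with the projections
  (\<open>fprod_base_change\<close>), it sends exchange maps to exchange maps (\<open>pb_mor_exch\<close>).

  Condition (c): for a section \<open>s\<close> of \<open>p\<^sub>P\<close>, the maps \<open>p\<^sub>A\<^sup>*(s)\<close> and \<open>q(s, P \<times>\<^sub>\<Gamma> A)\<close> are both the map
  from \<open>A\<close> with components \<open>Id\<^sub>A\<close> and \<open>p\<^sub>A \<odot> s\<close>, so that the exchange map takes one to the other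
  (\<open>section_exch\<close>).  The two functions on sections required to be bijective are therefore equal.

  All of this needs \<open>P\<close> to lie strictly above \<open>\<Gamma>\<close>, which \<open>ft P = \<Gamma>\<close> alone does not give because
  \<open>ft pt = pt\<close>; stability of \<open>PiF\<close> under base change excludes the case \<open>P = pt\<close> (\<open>len_Pi\<close>).
\<close>

context c_system
begin

section \<open>Pullback squares\<close>

lemma HomD:
  assumes "f \<in> Hom X Y"
  shows "f \<in> Mor" "Dom f = X" "Cod f = Y" "X \<in> Ob" "Y \<in> Ob"
  using assms Dom_Ob Cod_Ob by (auto simp: Hom_def)

lemma pullback_Hom:
  assumes "is_pullback CC a b f g"
  shows "a \<in> Hom (Dom a) (Dom f)" "b \<in> Hom (Dom a) (Dom g)"
    "f \<in> Hom (Dom f) (Cod f)" "g \<in> Hom (Dom g) (Cod f)" "a \<odot> f = b \<odot> g"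
  using assms by (auto simp: is_pullback_def Hom_def)

lemma pullback_ex:
  assumes "is_pullback CC a b f g"
    and "u \<in> Hom Z (Dom f)" "v \<in> Hom Z (Dom g)" "u \<odot> f = v \<odot> g"
  obtains w where "w \<in> Hom Z (Dom a)" "w \<odot> a = u" "w \<odot> b = v"
  using assms HomD(4)[OF assms(2)] unfolding is_pullback_def by blast

lemma pullback_eqI:
  assumes pb: "is_pullback CC a b f g"
    and w: "w \<in> Hom Z (Dom a)" "w' \<in> Hom Z (Dom a)"
    and eq: "w \<odot> a = w' \<odot> a" "w \<odot> b = w' \<odot> b"
  shows "w = w'"
proof -
  note H = pullback_Hom[OF pb]
  have u: "w \<odot> a \<in> Hom Z (Dom f)" and v: "w \<odot> b \<in> Hom Z (Dom g)"
    using cmp_Hom w(1) H by blast+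
  have "(w \<odot> a) \<odot> f = (w \<odot> b) \<odot> g"
    using cmp_assoc[OF w(1) H(1,3)] cmp_assoc[OF w(1) H(2,4)] H(5) by simp
  then have "\<exists>!x. x \<in> Hom Z (Dom a) \<and> x \<odot> a = w \<odot> a \<and> x \<odot> b = w \<odot> b"
    using pb u v HomD(4)[OF w(1)] unfolding is_pullback_def by blast
  then show ?thesis
    using w eq by metis
qed

lemma pullbackI:
  assumes "a \<in> Hom W X" "b \<in> Hom W Y" "f \<in> Hom X T" "g \<in> Hom Y T" "a \<odot> f = b \<odot> g"
    and "\<And>Z u v. u \<in> Hom Z X \<Longrightarrow> v \<in> Hom Z Y \<Longrightarrow> u \<odot> f = v \<odot> g \<Longrightarrow>
           \<exists>w. w \<in> Hom Z W \<and> w \<odot> a = u \<and> w \<odot> b = v"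
    and "\<And>Z w w'. w \<in> Hom Z W \<Longrightarrow> w' \<in> Hom Z W \<Longrightarrow> w \<odot> a = w' \<odot> a \<Longrightarrow>
           w \<odot> b = w' \<odot> b \<Longrightarrow> w = w'"
  shows "is_pullback CC a b f g"
proof -
  have "\<exists>!w. w \<in> Hom Z W \<and> w \<odot> a = u \<and> w \<odot> b = v"
    if "u \<in> Hom Z X" "v \<in> Hom Z Y" "u \<odot> f = v \<odot> g" for Z u v
    using assms(6)[OF that] assms(7)[of _ Z] by metis
  moreover have "Dom a = W" "Dom b = W" "Dom f = X" "Dom g = Y" "Cod a = X" "Cod b = Y"
    "Cod f = T" "Cod g = T" "a \<in> Mor" "b \<in> Mor" "f \<in> Mor" "g \<in> Mor"
    using assms(1-4) by (auto simp: Hom_def)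
  ultimately show ?thesis
    using assms(5) unfolding is_pullback_def by simp
qed

lemma pullback_refl:
  assumes f: "f \<in> Hom X Y"
  shows "is_pullback CC (idm X) f f (idm Y)"
proof (rule pullbackI)
  show "idm X \<in> Hom X X" "idm Y \<in> Hom Y Y" "f \<in> Hom X Y" "f \<in> Hom X Y"
    using idm_Hom HomD[OF f] f by auto
  show "idm X \<odot> f = f \<odot> idm Y"
    using idm_left[OF f] idm_right[OF f] by simp
  show "\<exists>w. w \<in> Hom Z X \<and> w \<odot> idm X = u \<and> w \<odot> f = v"
    if "u \<in> Hom Z X" "v \<in> Hom Z Y" "u \<odot> f = v \<odot> idm Y" for Z u v
    using that idm_right by metis
  show "w = w'" if "w \<in> Hom Z X" "w' \<in> Hom Z X" "w \<odot> idm X = w' \<odot> idm X" for Z w w'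
    using that idm_right by metis
qed

text \<open>The pasting law, in the direction that builds a large square out of two small ones.\<close>

lemma pullback_paste:
  assumes upper: "is_pullback CC a b f g" and lower: "is_pullback CC a' f f' g'"
  shows "is_pullback CC (a \<odot> a') b f' (g \<odot> g')"
proof -
  note U = pullback_Hom[OF upper] and L = pullback_Hom[OF lower]
  have D: "Dom a' = Dom f" "Cod f = Dom g'"
    using U L HomD by metis+
  have a': "a' \<in> Hom (Dom f) (Dom f')" and g': "g' \<in> Hom (Cod f) (Cod f')"
    using L(1,4) D by simp_all
  show ?thesis
  proof (rule pullbackI)
    show "a \<odot> a' \<in> Hom (Dom a) (Dom f')" "g \<odot> g' \<in> Hom (Dom g) (Cod f')"
      using cmp_Hom[OF U(1) a'] cmp_Hom[OF U(4) g'] .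
    show "b \<in> Hom (Dom a) (Dom g)" "f' \<in> Hom (Dom f') (Cod f')"
      using U L by auto
    show "(a \<odot> a') \<odot> f' = b \<odot> (g \<odot> g')"
      using cmp_assoc[OF U(1) a' L(3)] cmp_assoc[OF U(1,3) g'] cmp_assoc[OF U(2,4) g'] U(5) L(5)
      by simp
    show "\<exists>w. w \<in> Hom Z (Dom a) \<and> w \<odot> (a \<odot> a') = u \<and> w \<odot> b = v"
      if u: "u \<in> Hom Z (Dom f')" and v: "v \<in> Hom Z (Dom g)" and uv: "u \<odot> f' = v \<odot> (g \<odot> g')"
      for Z u v
    proof -
      have vg: "v \<odot> g \<in> Hom Z (Dom g')"
        using cmp_Hom[OF v U(4)] D by simp
      have "u \<odot> f' = (v \<odot> g) \<odot> g'"
        using uv cmp_assoc[OF v U(4) g'] by simp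
      from pullback_ex[OF lower u vg this]
      obtain x where x: "x \<in> Hom Z (Dom f)" "x \<odot> a' = u" "x \<odot> f = v \<odot> g"
        using D by auto
      from pullback_ex[OF upper x(1) v x(3)]
      obtain w where w: "w \<in> Hom Z (Dom a)" "w \<odot> a = x" "w \<odot> b = v" .
      then have "w \<odot> (a \<odot> a') = u"
        using cmp_assoc[OF w(1) U(1) a'] x by simp
      then show ?thesis
        using w by blast
    qed
    show "w = w'"
      if w: "w \<in> Hom Z (Dom a)" "w' \<in> Hom Z (Dom a)"
        and eq: "w \<odot> (a \<odot> a') = w' \<odot> (a \<odot> a')" "w \<odot> b = w' \<odot> b" for Z w w'
    proof -
      have "w \<odot> a = w' \<odot> a"
      proof (rule pullback_eqI[OF lower])
        show "w \<odot> a \<in> Hom Z (Dom a')" "w' \<odot> a \<in> Hom Z (Dom a')"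
          using cmp_Hom w U(1) D by metis+
        show "(w \<odot> a) \<odot> a' = (w' \<odot> a) \<odot> a'"
          using cmp_assoc[OF w(1) U(1) a'] cmp_assoc[OF w(2) U(1) a'] eq(1) by simp
        show "(w \<odot> a) \<odot> f = (w' \<odot> a) \<odot> f"
          using cmp_assoc[OF w(1) U(1,3)] cmp_assoc[OF w(2) U(1,3)]
            cmp_assoc[OF w(1) U(2,4)] cmp_assoc[OF w(2) U(2,4)] U(5) eq(2) by simp
      qed
      then show ?thesis
        using pullback_eqI[OF upper w] eq(2) by blast
    qed
  qed
qed

section \<open>Iterated canonical pullbacks\<close>

lemma pb_square:
  assumes "X \<in> Ob" "len X > 0" "f \<in> Hom Y (ft X)"
  shows "q f X \<in> Hom (pb f X) X" "pr (pb f X) \<in> Hom (pb f X) Y" "pr X \<in> Hom X (ft X)"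
    "pr (pb f X) \<odot> f = q f X \<odot> pr X"
  using assms q_Hom pr_Hom[OF pb_Ob[OF assms]] pr_Hom ft_pb[OF assms]
    pullback_Hom(5)[OF square_pullback[OF assms]] by auto

lemma len_pb_eq:
  assumes "X \<in> Ob" "len X > 0" "f \<in> Hom Y (ft X)"
  shows "len (pb f X) = Suc (len Y)"
  using len_ft[OF pb_Ob[OF assms] len_pb[OF assms]] len_pb[OF assms] ft_pb[OF assms] by simp

text \<open>Each step of the recursion adds one canonical square on top of the squares already built, so
  induction and pasting show that the iterated square is cartesian.  The number of steps \<open>n\<close> is the
  induction variable because \<open>pb_iter\<close>, \<open>q_iter\<close> and \<open>pr_iter\<close> recurse on it.\<close>

lemma iter_pullback:
  assumes "X \<in> Ob" "n \<le> len X" "f \<in> Hom G' ((ft ^^ n) X)"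
  shows "pb_iter CC n f X \<in> Ob \<and> len (pb_iter CC n f X) = len G' + n \<and>
    (ft ^^ n) (pb_iter CC n f X) = G' \<and> q_iter CC n f X \<in> Hom (pb_iter CC n f X) X \<and>
    is_pullback CC (pr_iter CC n (pb_iter CC n f X)) (q_iter CC n f X) f (pr_iter CC n X)"
  using assms
proof (induction n arbitrary: X)
  case 0
  then show ?case
    using HomD[of f G' X] pullback_refl[of f G' X] by simp
next
  case (Suc n)
  have lX: "len X > 0"
    using Suc.prems by simp
  have "n \<le> len (ft X)" "f \<in> Hom G' ((ft ^^ n) (ft X))"
    using Suc.prems len_ft[OF Suc.prems(1) lX] by (simp_all add: funpow_swap1)
  note IH = Suc.IH[OF ft_Ob[OF Suc.prems(1)] this]
  let ?q = "q_iter CC n f (ft X)"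
  have q: "?q \<in> Hom (pb_iter CC n f (ft X)) (ft X)"
    using IH by blast
  note * = Suc.prems(1) lX q
  show ?case
    using IH pb_Ob[OF *] len_pb_eq[OF *] ft_pb[OF *] q_Hom[OF *]
      pullback_paste[OF square_pullback[OF *], of _ f]
    by (simp add: funpow_swap1)
qed

text \<open>Avoids the length difference in the definition of \<open>over\<close>: any number of steps that stays
  within the length of \<open>X\<close> will do as a witness.\<close>

lemma over_iff:
  "over CC X G \<longleftrightarrow> X \<in> Ob \<and> (\<exists>n \<le> len X. G = (ft ^^ n) X)" (is "_ = ?R")
proof
  assume ?R
  then obtain n where n: "X \<in> Ob" "n \<le> len X" "G = (ft ^^ n) X"
    by blast
  have "(ft ^^ n) X \<in> Ob \<and> len ((ft ^^ n) X) = len X - n"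
    using n(2)
  proof (induction n)
    case 0
    then show ?case using n(1) by simp
  next
    case (Suc n)
    then have "(ft ^^ n) X \<in> Ob" "len ((ft ^^ n) X) = len X - n" "len X - n > 0"
      by simp_all
    then show ?case
      using ft_Ob[of "(ft ^^ n) X"] len_ft[of "(ft ^^ n) X"] by simp
  qed
  then show "over CC X G"
    using n by (simp add: over_def)
qed (auto simp: over_def intro!: exI[of _ "len X - len G"])

lemma ext_pullback:
  assumes X: "over CC X G" and f: "f \<in> Hom G' G"
  shows "over CC (pb_ext CC f X) G'" "q_ext CC f X \<in> Hom (pb_ext CC f X) X"
    "is_pullback CC (pr_to CC (pb_ext CC f X) G') (q_ext CC f X) f (pr_to CC X G)"
proof -
  let ?n = "len X - len G"
  have "X \<in> Ob" "?n \<le> len X" "f \<in> Hom G' ((ft ^^ ?n) X)"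
    using X f by (auto simp: over_def)
  note I = iter_pullback[OF this]
  have "Cod f = G"
    using HomD(3)[OF f] .
  then show "over CC (pb_ext CC f X) G'" "q_ext CC f X \<in> Hom (pb_ext CC f X) X"
    "is_pullback CC (pr_to CC (pb_ext CC f X) G') (q_ext CC f X) f (pr_to CC X G)"
    using I HomD[OF f] by (simp_all add: over_def q_ext_def pb_ext_def pr_to_def)
qed

text \<open>Read off from the pullback square along the identity of the base.\<close>

lemma pr_to_Hom:
  assumes "over CC X G"
  shows "pr_to CC X G \<in> Hom X G"
proof -
  have G: "idm G \<in> Hom G G"
    using assms idm_Hom by (simp add: over_def)
  note P = ext_pullback[OF assms G]
  have "Dom (pr_to CC X G) = X" "Cod (q_ext CC (idm G) X) = X"
    using HomD[OF P(2)] P(3) by (simp_all add: is_pullback_def)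
  then show ?thesis
    using pullback_Hom(4)[OF P(3)] HomD[OF G] by simp
qed

lemma one_step:
  assumes "X \<in> Ob" "len X > 0"
  shows "over CC X (ft X)" "pr_to CC X (ft X) = pr X"
    and "f \<in> Hom Y (ft X) \<Longrightarrow> q_ext CC f X = q f X"
    and "f \<in> Hom Y (ft X) \<Longrightarrow> pb_ext CC f X = pb f X"
proof -
  show "over CC X (ft X)"
    using assms by (auto simp: over_iff intro!: exI[of _ 1])
  have l: "len X - len (ft X) = Suc 0"
    using len_ft[OF assms] assms(2) by simp
  then show "pr_to CC X (ft X) = pr X"
    using idm_right[OF pr_Hom[OF assms(1)]] by (simp add: pr_to_def)
  show "q_ext CC f X = q f X" "pb_ext CC f X = pb f X" if "f \<in> Hom Y (ft X)"
    using l HomD[OF that] by (simp_all add: q_ext_def pb_ext_def)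
qed

lemma two_steps:
  assumes "X \<in> Ob" "len X \<ge> 2"
  shows "over CC X (ft (ft X))" "pr_to CC X (ft (ft X)) = pr X \<odot> pr (ft X)"
    and "f \<in> Hom Y (ft (ft X)) \<Longrightarrow> q_ext CC f X = q (q f (ft X)) X"
    and "f \<in> Hom Y (ft (ft X)) \<Longrightarrow> pb_ext CC f X = pb (q f (ft X)) X"
proof -
  show "over CC X (ft (ft X))"
    using assms by (auto simp: over_iff numeral_2_eq_2 intro!: exI[of _ 2])
  have l1: "len (ft X) = len X - 1"
    using len_ft[of X] assms by simp
  then have l: "len X - len (ft (ft X)) = Suc (Suc 0)"
    using len_ft[of "ft X"] ft_Ob assms by simp
  then show "pr_to CC X (ft (ft X)) = pr X \<odot> pr (ft X)"
    using idm_right[OF pr_Hom[OF ft_Ob[OF assms(1)]]] by (simp add: pr_to_def)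
  show "q_ext CC f X = q (q f (ft X)) X" "pb_ext CC f X = pb (q f (ft X)) X"
    if "f \<in> Hom Y (ft (ft X))"
    using l HomD[OF that] by (simp_all add: q_ext_def pb_ext_def)
qed

section \<open>Base change of morphisms\<close>

lemma mor_over_iff:
  assumes "a \<in> Hom X Y"
  shows "mor_over CC G a \<longleftrightarrow> over CC X G \<and> over CC Y G \<and> a \<odot> pr_to CC Y G = pr_to CC X G"
  using HomD[OF assms] by (simp add: mor_over_def)

text \<open>The cartesian square over \<open>f\<close> and \<open>pr_to CC Y G\<close> makes the definite description in \<open>pb_mor\<close>
  well defined.  The equivalence serves both to compute a base change, by exhibiting a candidate, and
  to extract the properties of one that is given.\<close>

lemma pb_mor_iff:
  assumes a: "a \<in> Hom X Y" "mor_over CC G a" and f: "f \<in> Hom G' G"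
  shows "pb_mor CC f a = b \<longleftrightarrow>
    b \<in> Hom (pb_ext CC f X) (pb_ext CC f Y) \<and> mor_over CC G' b \<and>
    b \<odot> q_ext CC f Y = q_ext CC f X \<odot> a" (is "_ = ?P b")
proof -
  have o: "over CC X G" "over CC Y G" and pa: "a \<odot> pr_to CC Y G = pr_to CC X G"
    using a mor_over_iff by auto
  note X = ext_pullback[OF o(1) f] and Y = ext_pullback[OF o(2) f]
  note pX = pr_to_Hom[OF o(1)] pr_to_Hom[OF X(1)] and pY = pr_to_Hom[OF o(2)] pr_to_Hom[OF Y(1)]
  have iff: "?P b \<longleftrightarrow> b \<in> Hom (pb_ext CC f X) (pb_ext CC f Y) \<and>
      b \<odot> pr_to CC (pb_ext CC f Y) G' = pr_to CC (pb_ext CC f X) G' \<and>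
      b \<odot> q_ext CC f Y = q_ext CC f X \<odot> a" for b
    using mor_over_iff X(1) Y(1) by blast
  have qa: "q_ext CC f X \<odot> a \<in> Hom (pb_ext CC f X) Y"
    using cmp_Hom[OF X(2) a(1)] .
  have "pr_to CC (pb_ext CC f X) G' \<odot> f = (q_ext CC f X \<odot> a) \<odot> pr_to CC Y G"
    using cmp_assoc[OF X(2) a(1) pY(1)] pa pullback_Hom(5)[OF X(3)] by simp
  then have "\<exists>b. ?P b"
    using pullback_ex[OF Y(3), of "pr_to CC (pb_ext CC f X) G'" "pb_ext CC f X" "q_ext CC f X \<odot> a"]
      pX(2) qa HomD[OF f] HomD[OF pY(1)] HomD[OF pY(2)] iff by metis
  moreover have "b = b'" if "?P b" "?P b'" for b b'
    using that pullback_eqI[OF Y(3)] HomD[OF pY(2)] iff by metis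
  ultimately have ex1: "\<exists>!b. ?P b"
    by blast
  have "pb_mor CC f a = (THE b. ?P b)"
    using HomD[OF a(1)] HomD[OF f] by (simp add: pb_mor_def)
  then show ?thesis
    using theI'[OF ex1] ex1 by metis
qed

lemma mor_over_cmp:
  assumes a: "a \<in> Hom X Y" "mor_over CC G a" and b: "b \<in> Hom Y Z" "mor_over CC G b"
  shows "mor_over CC G (a \<odot> b)"
  using a b mor_over_iff[OF a(1)] mor_over_iff[OF b(1)] mor_over_iff[OF cmp_Hom[OF a(1) b(1)]]
    cmp_assoc[OF a(1) b(1) pr_to_Hom] by simp

lemma pb_mor_cmp:
  assumes a: "a \<in> Hom X Y" "mor_over CC G a" and b: "b \<in> Hom Y Z" "mor_over CC G b"
    and f: "f \<in> Hom G' G"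
  shows "pb_mor CC f (a \<odot> b) = pb_mor CC f a \<odot> pb_mor CC f b"
proof -
  let ?a = "pb_mor CC f a" and ?b = "pb_mor CC f b"
  have o: "over CC X G" "over CC Y G" "over CC Z G"
    using a b mor_over_iff by auto
  note q = o[THEN ext_pullback(2), OF f]
  have A: "?a \<in> Hom (pb_ext CC f X) (pb_ext CC f Y)" "mor_over CC G' ?a"
      "?a \<odot> q_ext CC f Y = q_ext CC f X \<odot> a"
    using pb_mor_iff[OF a f] by blast+
  have B: "?b \<in> Hom (pb_ext CC f Y) (pb_ext CC f Z)" "mor_over CC G' ?b"
      "?b \<odot> q_ext CC f Z = q_ext CC f Y \<odot> b"
    using pb_mor_iff[OF b f] by blast+
  have "(?a \<odot> ?b) \<odot> q_ext CC f Z = q_ext CC f X \<odot> (a \<odot> b)"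
    using cmp_assoc[OF A(1) B(1) q(3)] cmp_assoc[OF A(1) q(2) b(1)] cmp_assoc[OF q(1) a(1) b(1)]
      A(3) B(3) by simp
  then show ?thesis
    using pb_mor_iff[OF cmp_Hom[OF a(1) b(1)] mor_over_cmp[OF a b] f] cmp_Hom[OF A(1) B(1)]
      mor_over_cmp[OF A(1,2) B(1,2)] by blast
qed

end

section \<open>The exchange isomorphism\<close>

text \<open>The hypotheses are symmetric in \<open>X\<close> and \<open>Y\<close>, so that every fact about \<open>X \<times>\<^sub>G Y\<close> becomes one
  about \<open>Y \<times>\<^sub>G X\<close> through the interpretation given by \<open>swap\<close>.\<close>

locale sibling_objects = c_system +
  fixes X Y G
  assumes X: "X \<in> Ob" "len X > 0" "ft X = G"
    and Y: "Y \<in> Ob" "len Y > 0" "ft Y = G"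
begin

lemma swap: "sibling_objects CC Y X G"
  using X Y by unfold_locales

lemma pr: "pr X \<in> Hom X G" "pr Y \<in> Hom Y G"
  using pr_Hom[OF X(1)] pr_Hom[OF Y(1)] X(3) Y(3) by metis+

lemma prXY: "pr X \<in> Hom X (ft Y)" "pr Y \<in> Hom Y (ft X)"
  using pr X Y by auto

lemma fprod_eq: "fprod CC X Y G = pb (pr X) Y" "pr_to CC X G = pr X"
  "q_ext CC (pr_to CC X G) Y = q (pr X) Y"
  "pr_to CC (fprod CC X Y G) X = pr (fprod CC X Y G)"
proof -
  show *: "pr_to CC X G = pr X"
    using one_step(2) X by auto
  show **: "fprod CC X Y G = pb (pr X) Y"
    using one_step(4)[OF Y(1,2) prXY(1)] * by (simp add: fprod_def)
  show "q_ext CC (pr_to CC X G) Y = q (pr X) Y"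
    using one_step(3)[OF Y(1,2) prXY(1)] * by simp
  show "pr_to CC (fprod CC X Y G) X = pr (fprod CC X Y G)"
    using one_step(2)[OF pb_Ob[OF Y(1,2) prXY(1)] len_pb[OF Y(1,2) prXY(1)]]
      ft_pb[OF Y(1,2) prXY(1)] ** by simp
qed

lemma fprod_Ob: "fprod CC X Y G \<in> Ob" "len (fprod CC X Y G) \<ge> 2" "ft (fprod CC X Y G) = X"
  using pb_Ob[OF Y(1,2) prXY(1)] len_pb_eq[OF Y(1,2) prXY(1)] ft_pb[OF Y(1,2) prXY(1)] fprod_eq X
  by auto

lemma fprod_over: "over CC (fprod CC X Y G) G"
  "pr_to CC (fprod CC X Y G) G = pr (fprod CC X Y G) \<odot> pr X"
  using two_steps(1,2)[OF fprod_Ob(1,2)] fprod_Ob X by auto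

lemma fprod_pullback:
  "is_pullback CC (pr (fprod CC X Y G)) (q (pr X) Y) (pr X) (pr Y)"
  using square_pullback[OF Y(1,2) prXY(1)] fprod_eq by simp

lemma fprod_Hom:
  "pr (fprod CC X Y G) \<in> Hom (fprod CC X Y G) X" "q (pr X) Y \<in> Hom (fprod CC X Y G) Y"
  "pr (fprod CC X Y G) \<odot> pr X = q (pr X) Y \<odot> pr Y"
  using pb_square[OF Y(1,2) prXY(1)] fprod_eq by auto

lemma fprod_eqI:
  assumes "w \<in> Hom Z (fprod CC X Y G)" "w' \<in> Hom Z (fprod CC X Y G)"
    and "w \<odot> pr (fprod CC X Y G) = w' \<odot> pr (fprod CC X Y G)"
    and "w \<odot> q (pr X) Y = w' \<odot> q (pr X) Y"
  shows "w = w'"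
  using pullback_eqI[OF fprod_pullback, of w Z w'] assms HomD[OF fprod_Hom(1)] by simp

text \<open>The two orders of the product are pullbacks of the same cospan, so the projections of one
  factor uniquely through the other.\<close>

lemma exch_properties:
  "exch CC X Y G \<in> Hom (fprod CC X Y G) (fprod CC Y X G) \<and>
   exch CC X Y G \<odot> q (pr Y) X = pr (fprod CC X Y G) \<and>
   exch CC X Y G \<odot> pr (fprod CC Y X G) = q (pr X) Y"
proof -
  interpret S: sibling_objects CC Y X G
    by (rule swap)
  let ?P = "\<lambda>e. e \<in> Hom (fprod CC X Y G) (fprod CC Y X G) \<and>
     e \<odot> q (pr Y) X = pr (fprod CC X Y G) \<and> e \<odot> pr (fprod CC Y X G) = q (pr X) Y"
  have "\<exists>e. ?P e"
    using pullback_ex[OF S.fprod_pullback, of "q (pr X) Y" "fprod CC X Y G" "pr (fprod CC X Y G)"]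
      fprod_Hom HomD[OF S.fprod_Hom(1)] HomD[OF pr(1)] HomD[OF pr(2)] by metis
  moreover have "e = e'" if "?P e" "?P e'" for e e'
    using that S.fprod_eqI by metis
  ultimately have "\<exists>!e. ?P e"
    by blast
  from theI'[OF this] show ?thesis
    unfolding exch_def fprod_eq(3,4) S.fprod_eq(3,4) .
qed

lemmas exch_Hom = exch_properties[THEN conjunct1]
  and exch_q = exch_properties[THEN conjunct2, THEN conjunct1]
  and exch_pr = exch_properties[THEN conjunct2, THEN conjunct2]

lemma exch_exch: "exch CC X Y G \<odot> exch CC Y X G = idm (fprod CC X Y G)"
proof -
  interpret S: sibling_objects CC Y X G
    by (rule swap)
  note h = exch_Hom S.exch_Hom
  have i: "idm (fprod CC X Y G) \<in> Hom (fprod CC X Y G) (fprod CC X Y G)"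
    using idm_Hom fprod_Ob by blast
  show ?thesis
  proof (rule fprod_eqI[OF cmp_Hom[OF h] i])
    show "(exch CC X Y G \<odot> exch CC Y X G) \<odot> pr (fprod CC X Y G) =
        idm (fprod CC X Y G) \<odot> pr (fprod CC X Y G)"
      using cmp_assoc[OF h fprod_Hom(1)] S.exch_pr exch_q idm_left[OF fprod_Hom(1)] by simp
    show "(exch CC X Y G \<odot> exch CC Y X G) \<odot> q (pr X) Y = idm (fprod CC X Y G) \<odot> q (pr X) Y"
      using cmp_assoc[OF h fprod_Hom(2)] S.exch_q exch_pr idm_left[OF fprod_Hom(2)] by simp
  qed
qed

lemma exch_exch_cmp:
  assumes "a \<in> Hom (fprod CC X Y G) Z"
  shows "exch CC X Y G \<odot> (exch CC Y X G \<odot> a) = a"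
proof -
  interpret S: sibling_objects CC Y X G
    by (rule swap)
  show ?thesis
    using cmp_assoc[OF exch_Hom S.exch_Hom assms] exch_exch idm_left[OF assms] by simp
qed

lemma exch_over: "mor_over CC G (exch CC X Y G)"
proof -
  interpret S: sibling_objects CC Y X G
    by (rule swap)
  have "exch CC X Y G \<odot> (pr (fprod CC Y X G) \<odot> pr Y) = pr (fprod CC X Y G) \<odot> pr X"
    using cmp_assoc[OF exch_Hom S.fprod_Hom(1) pr(2)] exch_pr fprod_Hom(3) by simp
  then show ?thesis
    using mor_over_iff[OF exch_Hom] fprod_over S.fprod_over by simp
qed

lemma siblings_base_change:
  assumes f: "f \<in> Hom G' G"
  shows "sibling_objects CC (pb f X) (pb f Y) G'"
proof -
  have f': "f \<in> Hom G' (ft X)" "f \<in> Hom G' (ft Y)"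
    using f X Y by auto
  show ?thesis
    using pb_Ob[OF X(1,2) f'(1)] pb_Ob[OF Y(1,2) f'(2)] len_pb[OF X(1,2) f'(1)]
      len_pb[OF Y(1,2) f'(2)] ft_pb[OF X(1,2) f'(1)] ft_pb[OF Y(1,2) f'(2)] by unfold_locales
qed

text \<open>Both sides of the first equation come from one composite map \<open>pb f X \<rightarrow> G\<close>, written as
  \<open>q f X \<odot> pr X\<close> and as \<open>pr (pb f X) \<odot> f\<close>: the strict functoriality laws \<open>pb_cmp\<close> and \<open>q_cmp\<close>,
  applied to the two factorizations, identify the objects and the maps to \<open>Y\<close>.\<close>

lemma fprod_base_change:
  assumes f: "f \<in> Hom G' G"
  shows "pb_ext CC f (fprod CC X Y G) = fprod CC (pb f X) (pb f Y) G'"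
    and "q_ext CC f (fprod CC X Y G) \<in> Hom (fprod CC (pb f X) (pb f Y) G') (fprod CC X Y G)"
    and "q_ext CC f (fprod CC X Y G) \<odot> pr (fprod CC X Y G) =
         pr (fprod CC (pb f X) (pb f Y) G') \<odot> q f X"
    and "q_ext CC f (fprod CC X Y G) \<odot> q (pr X) Y = q (pr (pb f X)) (pb f Y) \<odot> q f Y"
proof -
  interpret B: sibling_objects CC "pb f X" "pb f Y" G'
    using siblings_base_change[OF f] .
  have f': "f \<in> Hom G' (ft X)" "f \<in> Hom G' (ft Y)" "f \<in> Hom G' (ft (ft (fprod CC X Y G)))"
    using f X Y fprod_Ob by auto
  have ff: "ft (fprod CC X Y G) = X" "len (fprod CC X Y G) > 0"
    using fprod_Ob by auto
  note qX = pb_square[OF X(1,2) f'(1)]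
  have qX': "q f X \<in> Hom (pb f X) (ft (fprod CC X Y G))"
    using qX ff by simp
  have e: "pb_ext CC f (fprod CC X Y G) = pb (q f X) (pb (pr X) Y)"
      "q_ext CC f (fprod CC X Y G) = q (q f X) (pb (pr X) Y)"
    using two_steps(3,4)[OF fprod_Ob(1,2) f'(3)] ff fprod_eq by simp_all
  have pf: "pr (pb f X) \<in> Hom (pb f X) G'"
    using qX by blast
  have "pb (q f X \<odot> pr X) Y = pb (q f X) (pb (pr X) Y)"
       "q (q f X \<odot> pr X) Y = q (q f X) (pb (pr X) Y) \<odot> q (pr X) Y"
    using pb_cmp[OF Y(1,2) qX(1) prXY(1)] q_cmp[OF Y(1,2) qX(1) prXY(1)] by auto
  moreover have "pb (pr (pb f X) \<odot> f) Y = pb (pr (pb f X)) (pb f Y)"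
       "q (pr (pb f X) \<odot> f) Y = q (pr (pb f X)) (pb f Y) \<odot> q f Y"
    using pb_cmp[OF Y(1,2) pf f'(2)] q_cmp[OF Y(1,2) pf f'(2)] by auto
  ultimately show 1: "pb_ext CC f (fprod CC X Y G) = fprod CC (pb f X) (pb f Y) G'"
    and "q_ext CC f (fprod CC X Y G) \<odot> q (pr X) Y = q (pr (pb f X)) (pb f Y) \<odot> q f Y"
    using qX(4) e B.fprod_eq(1) by auto
  show "q_ext CC f (fprod CC X Y G) \<in> Hom (fprod CC (pb f X) (pb f Y) G') (fprod CC X Y G)"
    using ext_pullback(2)[OF fprod_over(1) f] 1 by simp
  show "q_ext CC f (fprod CC X Y G) \<odot> pr (fprod CC X Y G) =
         pr (fprod CC (pb f X) (pb f Y) G') \<odot> q f X"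
    using pb_square(4)[OF fprod_Ob(1) ff(2) qX'] 1 e fprod_eq(1) by simp
qed

text \<open>Naturality of the exchange map is checked on the two projections of \<open>fprod CC Y X G\<close>, where it
  reduces to the compatibility of \<open>q_ext\<close> with the projections.\<close>

lemma pb_mor_exch:
  assumes f: "f \<in> Hom G' G"
  shows "pb_mor CC f (exch CC X Y G) = exch CC (pb f X) (pb f Y) G'"
proof -
  interpret S: sibling_objects CC Y X G
    by (rule swap)
  interpret B: sibling_objects CC "pb f X" "pb f Y" G'
    using siblings_base_change[OF f] .
  interpret BS: sibling_objects CC "pb f Y" "pb f X" G'
    by (rule B.swap)
  let ?e = "exch CC X Y G" and ?e' = "exch CC (pb f X) (pb f Y) G'"
  let ?r = "q_ext CC f (fprod CC X Y G)" and ?r' = "q_ext CC f (fprod CC Y X G)"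
  note r = fprod_base_change[OF f] and r' = S.fprod_base_change[OF f]
  have f': "f \<in> Hom G' (ft X)" "f \<in> Hom G' (ft Y)"
    using f X Y by auto
  note qX = pb_square(1)[OF X(1,2) f'(1)] and qY = pb_square(1)[OF Y(1,2) f'(2)]
  have "?e' \<odot> ?r' = ?r \<odot> ?e"
  proof (rule S.fprod_eqI[OF cmp_Hom[OF B.exch_Hom r'(2)] cmp_Hom[OF r(2) exch_Hom]])
    have "(?e' \<odot> ?r') \<odot> pr (fprod CC Y X G) = q (pr (pb f X)) (pb f Y) \<odot> q f Y"
      using cmp_assoc[OF B.exch_Hom r'(2) S.fprod_Hom(1)] r'(3)
        cmp_assoc[OF B.exch_Hom BS.fprod_Hom(1) qY] B.exch_pr by simp
    also have "\<dots> = (?r \<odot> ?e) \<odot> pr (fprod CC Y X G)"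
      using cmp_assoc[OF r(2) exch_Hom S.fprod_Hom(1)] exch_pr r(4) by simp
    finally show "(?e' \<odot> ?r') \<odot> pr (fprod CC Y X G) = (?r \<odot> ?e) \<odot> pr (fprod CC Y X G)" .
    have "(?e' \<odot> ?r') \<odot> q (pr Y) X = pr (fprod CC (pb f X) (pb f Y) G') \<odot> q f X"
      using cmp_assoc[OF B.exch_Hom r'(2) S.fprod_Hom(2)] r'(4)
        cmp_assoc[OF B.exch_Hom BS.fprod_Hom(2) qX] B.exch_q by simp
    also have "\<dots> = (?r \<odot> ?e) \<odot> q (pr Y) X"
      using cmp_assoc[OF r(2) exch_Hom S.fprod_Hom(2)] exch_q r(3) by simp
    finally show "(?e' \<odot> ?r') \<odot> q (pr Y) X = (?r \<odot> ?e) \<odot> q (pr Y) X" .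
  qed
  then show ?thesis
    using pb_mor_iff[OF exch_Hom exch_over f] r(1) r'(1) B.exch_Hom B.exch_over by simp
qed

lemma pb_mor_exch_cmp:
  assumes a: "a \<in> Hom (fprod CC Y X G) Z" "mor_over CC G a" and f: "f \<in> Hom G' G"
  shows "pb_mor CC f (exch CC X Y G \<odot> a) = exch CC (pb f X) (pb f Y) G' \<odot> pb_mor CC f a"
  using pb_mor_cmp[OF exch_Hom exch_over a f] pb_mor_exch[OF f] by simp

text \<open>Both sides of the last equation are the map \<open>X \<rightarrow> fprod CC Y X G\<close> with components
  \<open>pr X \<odot> s\<close> and \<open>idm X\<close>.  For the right-hand side this rests on the strict laws \<open>pb_idm\<close> and
  \<open>q_idm\<close>, since \<open>s \<odot> pr Y\<close> is an identity.\<close>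

lemma section_exch:
  assumes s: "s \<in> bdry_fiber CC Y"
  shows "pb_mor CC (pr X) s \<in> Hom X (fprod CC X Y G)"
    and "q_ext CC s (fprod CC Y X G) \<in> Hom X (fprod CC Y X G)"
    and "pb_mor CC (pr X) s \<odot> exch CC X Y G = q_ext CC s (fprod CC Y X G)"
proof -
  interpret S: sibling_objects CC Y X G
    by (rule swap)
  have "Cod s = Y" "s \<in> sec CC (pr Y)"
    using s by (auto simp: bdry_fiber_def bdry_def Ob_tilde_def)
  then have sH: "s \<in> Hom G Y" and sp: "s \<odot> pr Y = idm G"
    using HomD[OF pr(2)] by (auto simp: sec_def)
  have G: "G \<in> Ob"
    using HomD[OF sH] by simp
  have oY: "over CC Y G" and oG: "over CC G G"
    using one_step(1)[OF Y(1,2)] Y G by (auto simp: over_def)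
  have so: "mor_over CC G s"
    using mor_over_iff[OF sH] oY oG sp S.fprod_eq(2) pr_to_self[of G] by simp
  let ?t = "pb_mor CC (pr X) s"
  have eG: "pb_ext CC (pr X) G = X" "q_ext CC (pr X) G = pr X"
    using pb_ext_self[of "pr X"] q_ext_self[of "pr X"] HomD[OF pr(1)] by auto
  have eY: "pb_ext CC (pr X) Y = fprod CC X Y G" "q_ext CC (pr X) Y = q (pr X) Y"
    using fprod_eq fprod_def by (metis, metis)
  have T: "?t \<in> Hom X (fprod CC X Y G)" "mor_over CC X ?t" "?t \<odot> q (pr X) Y = pr X \<odot> s"
    using pb_mor_iff[OF sH so pr(1), of ?t] eG eY by auto
  have tp: "?t \<odot> pr (fprod CC X Y G) = idm X"
    using T(2) mor_over_iff[OF T(1)] fprod_eq(4) pr_to_self[of X] by simp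
  let ?w = "q_ext CC s (fprod CC Y X G)"
  have ff: "s \<in> Hom G (ft (fprod CC Y X G))" "len (fprod CC Y X G) > 0"
    using sH S.fprod_Ob by auto
  have w_eq: "?w = q s (fprod CC Y X G)"
    using one_step(3)[OF S.fprod_Ob(1) ff(2,1)] .
  have "pb s (pb (pr Y) X) = pb (idm (ft X)) X"
    using pb_cmp[OF X(1,2) sH prXY(2)] sp X(3) by simp
  then have pbX: "pb s (fprod CC Y X G) = X"
    using pb_idm[OF X(1,2)] S.fprod_eq(1) by simp
  have "q s (pb (pr Y) X) \<odot> q (pr Y) X = q (idm (ft X)) X"
    using q_cmp[OF X(1,2) sH prXY(2)] sp X(3) by simp
  then have wq: "?w \<odot> q (pr Y) X = idm X"
    using q_idm[OF X(1,2)] S.fprod_eq(1) w_eq by simp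
  note W = pb_square[OF S.fprod_Ob(1) ff(2,1)]
  have W1: "?w \<in> Hom X (fprod CC Y X G)" and wp: "?w \<odot> pr (fprod CC Y X G) = pr X \<odot> s"
    using W pbX w_eq by auto
  show "?t \<in> Hom X (fprod CC X Y G)" "?w \<in> Hom X (fprod CC Y X G)"
    by (fact T(1) W1)+
  show "?t \<odot> exch CC X Y G = ?w"
  proof (rule S.fprod_eqI[OF cmp_Hom[OF T(1) exch_Hom] W1])
    show "(?t \<odot> exch CC X Y G) \<odot> pr (fprod CC Y X G) = ?w \<odot> pr (fprod CC Y X G)"
      using cmp_assoc[OF T(1) exch_Hom S.fprod_Hom(1)] exch_pr T(3) wp by simp
    show "(?t \<odot> exch CC X Y G) \<odot> q (pr Y) X = ?w \<odot> q (pr Y) X"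
      using cmp_assoc[OF T(1) exch_Hom S.fprod_Hom(2)] exch_q tp wq by simp
  qed
qed

end

section \<open>Application families\<close>

locale pi_family = c_system +
  fixes PiF
  assumes Pi_Ob: "B \<in> Ob2 CC \<Longrightarrow> PiF B \<in> Ob"
    and ft_Pi: "B \<in> Ob2 CC \<Longrightarrow> ft (PiF B) = ft (ft B)"
    and Pi_pb: "\<lbrakk>B \<in> Ob2 CC; f \<in> Hom G' (ft (ft B))\<rbrakk> \<Longrightarrow> pb_ext CC f (PiF B) = PiF (pb_ext CC f B)"
begin

lemma Ob2_D:
  assumes "B \<in> Ob2 CC"
  shows "B \<in> Ob" "len B \<ge> 2" "len B > 0" "ft B \<in> Ob" "len (ft B) > 0" "len (ft B) < len B"
  using assms ft_Ob[of B] len_ft[of B] by (auto simp: Ob2_def)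

lemma Ob2_pb:
  assumes B: "B \<in> Ob2 CC" and f: "f \<in> Hom G' (ft (ft B))"
  shows "pb_ext CC f B \<in> Ob2 CC" "ft (pb_ext CC f B) = pb f (ft B)" "ft (ft (pb_ext CC f B)) = G'"
proof -
  note D = Ob2_D[OF B]
  note q = q_Hom[OF D(4,5) f]
  have e: "pb_ext CC f B = pb (q f (ft B)) B"
    using two_steps(4)[OF D(1,2) f] .
  show "ft (pb_ext CC f B) = pb f (ft B)"
    using ft_pb[OF D(1,3) q] e by simp
  then show "ft (ft (pb_ext CC f B)) = G'"
    using ft_pb[OF D(4,5) f] by simp
  show "pb_ext CC f B \<in> Ob2 CC"
    using pb_Ob[OF D(1,3) q] len_pb_eq[OF D(1,3) q] len_pb[OF D(4,5) f] e by (simp add: Ob2_def)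
qed

text \<open>Were \<open>PiF B\<close> of length zero, both it and \<open>ft (ft B)\<close> would be the final object.  Pulling \<open>B\<close>
  back along \<open>f : B \<rightarrow> pt\<close> then gives \<open>PiF (f\<^sup>*(B)) = f\<^sup>*(pt) = B\<close>, which \<open>ft_Pi\<close> turns into
  \<open>ft B = B\<close>, impossible for \<open>len B > 0\<close>.\<close>

lemma len_Pi:
  assumes B: "B \<in> Ob2 CC"
  shows "len (PiF B) > 0"
proof (rule ccontr)
  assume "\<not> len (PiF B) > 0"
  then have "PiF B = pt"
    using len_zero Pi_Ob[OF B] by auto
  then have G: "ft (ft B) = pt"
    using ft_Pi[OF B] ft_pt by simp
  obtain f where f: "f \<in> Hom B pt"
    using pt_final[OF Ob2_D(1)[OF B]] by blast
  then have fG: "f \<in> Hom B (ft (ft B))"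
    using G by simp
  have "PiF (pb_ext CC f B) = B"
    using Pi_pb[OF B fG] \<open>PiF B = pt\<close> pb_ext_self[of f] HomD[OF f] by simp
  then have "ft B = B"
    using ft_Pi[OF Ob2_pb(1)[OF B fG]] Ob2_pb(3)[OF B fG] by simp
  then show False
    using Ob2_D(6)[OF B] by simp
qed

lemma siblings:
  assumes "B \<in> Ob2 CC"
  shows "sibling_objects CC (ft B) (PiF B) (ft (ft B))"
  using Ob2_D[OF assms] Pi_Ob[OF assms] len_Pi[OF assms] ft_Pi[OF assms] by unfold_locales auto

lemma Pi_pb_one_step:
  assumes B: "B \<in> Ob2 CC" and f: "f \<in> Hom G' (ft (ft B))"
  shows "PiF (pb_ext CC f B) = pb f (PiF B)"
proof -
  have "f \<in> Hom G' (ft (PiF B))"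
    using f ft_Pi[OF B] by simp
  then show ?thesis
    using one_step(4)[OF Pi_Ob[OF B] len_Pi[OF B]] Pi_pb[OF B f] by simp
qed

lemma mor_over_ft_iff:
  assumes B: "B \<in> Ob2 CC" and a: "a \<in> Hom (fprod CC (ft B) (PiF B) (ft (ft B))) B"
  shows "mor_over CC (ft B) a \<longleftrightarrow> a \<odot> pr B = pr (fprod CC (ft B) (PiF B) (ft (ft B)))"
proof -
  interpret S: sibling_objects CC "ft B" "PiF B" "ft (ft B)"
    using siblings[OF B] .
  have "over CC (fprod CC (ft B) (PiF B) (ft (ft B))) (ft B)"
    using one_step(1)[OF S.fprod_Ob(1)] S.fprod_Ob by simp
  then show ?thesis
    using mor_over_iff[OF a] one_step(1,2)[OF Ob2_D(1,3)[OF B]] S.fprod_eq(4) by auto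
qed

lemma q_ext_pr_Pi:
  assumes "B \<in> Ob2 CC"
  shows "q_ext CC (pr (PiF B)) (ft B) = q (pr (PiF B)) (ft B)"
proof -
  interpret S: sibling_objects CC "PiF B" "ft B" "ft (ft B)"
    using sibling_objects.swap[OF siblings[OF assms]] .
  show ?thesis
    using S.fprod_eq(2,3) by simp
qed

text \<open>The next two lemmas transfer condition (a), since the exchange map turns the projection to
  \<open>ft B\<close> of one product into that of the other.  They also record that (a) makes \<open>Ap B\<close> a morphism
  over \<open>ft (ft B)\<close>, so that its base change in condition (b) makes sense.\<close>

lemma exch_mor_over_ft:
  assumes B: "B \<in> Ob2 CC"
    and a: "a \<in> Hom (fprod CC (PiF B) (ft B) (ft (ft B))) B"
      "a \<odot> pr B = q_ext CC (pr (PiF B)) (ft B)"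
  shows "exch CC (ft B) (PiF B) (ft (ft B)) \<odot> a \<in> Hom (fprod CC (ft B) (PiF B) (ft (ft B))) B"
    and "mor_over CC (ft B) (exch CC (ft B) (PiF B) (ft (ft B)) \<odot> a)"
    and "mor_over CC (ft (ft B)) a"
proof -
  interpret S: sibling_objects CC "ft B" "PiF B" "ft (ft B)"
    using siblings[OF B] .
  interpret T: sibling_objects CC "PiF B" "ft B" "ft (ft B)"
    using S.swap .
  note prB = pr_Hom[OF Ob2_D(1)[OF B]]
  show h: "exch CC (ft B) (PiF B) (ft (ft B)) \<odot> a \<in> Hom (fprod CC (ft B) (PiF B) (ft (ft B))) B"
    using cmp_Hom[OF S.exch_Hom a(1)] .
  show "mor_over CC (ft B) (exch CC (ft B) (PiF B) (ft (ft B)) \<odot> a)"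
    using mor_over_ft_iff[OF B h] cmp_assoc[OF S.exch_Hom a(1) prB] a(2) S.exch_q q_ext_pr_Pi[OF B]
    by simp
  have "a \<odot> (pr B \<odot> pr (ft B)) = pr (fprod CC (PiF B) (ft B) (ft (ft B))) \<odot> pr (PiF B)"
    using cmp_assoc[OF a(1) prB S.pr(1)] a(2) q_ext_pr_Pi[OF B] T.fprod_Hom(3) by simp
  then show "mor_over CC (ft (ft B)) a"
    using mor_over_iff[OF a(1)] two_steps(1,2)[OF Ob2_D(1,2)[OF B]] T.fprod_over by simp
qed

lemma exch_projection:
  assumes B: "B \<in> Ob2 CC"
    and a: "a \<in> Hom (fprod CC (ft B) (PiF B) (ft (ft B))) B" "mor_over CC (ft B) a"
  shows "exch CC (PiF B) (ft B) (ft (ft B)) \<odot> a \<in> Hom (fprod CC (PiF B) (ft B) (ft (ft B))) B"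
    and "(exch CC (PiF B) (ft B) (ft (ft B)) \<odot> a) \<odot> pr B = q_ext CC (pr (PiF B)) (ft B)"
    and "mor_over CC (ft (ft B)) a"
proof -
  interpret S: sibling_objects CC "ft B" "PiF B" "ft (ft B)"
    using siblings[OF B] .
  interpret T: sibling_objects CC "PiF B" "ft B" "ft (ft B)"
    using S.swap .
  note prB = pr_Hom[OF Ob2_D(1)[OF B]]
  have ap: "a \<odot> pr B = pr (fprod CC (ft B) (PiF B) (ft (ft B)))"
    using mor_over_ft_iff[OF B] a by simp
  show "exch CC (PiF B) (ft B) (ft (ft B)) \<odot> a \<in> Hom (fprod CC (PiF B) (ft B) (ft (ft B))) B"
    using cmp_Hom[OF T.exch_Hom a(1)] .
  show "(exch CC (PiF B) (ft B) (ft (ft B)) \<odot> a) \<odot> pr B = q_ext CC (pr (PiF B)) (ft B)"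
    using cmp_assoc[OF T.exch_Hom a(1) prB] ap T.exch_pr q_ext_pr_Pi[OF B] by simp
  have "a \<odot> (pr B \<odot> pr (ft B)) = pr (fprod CC (ft B) (PiF B) (ft (ft B))) \<odot> pr (ft B)"
    using cmp_assoc[OF a(1) prB S.pr(1)] ap by simp
  then show "mor_over CC (ft (ft B)) a"
    using mor_over_iff[OF a(1)] two_steps(1,2)[OF Ob2_D(1,2)[OF B]] S.fprod_over by simp
qed

lemma AllAp1_iff:
  "Ap \<in> AllAp1 CC PiF \<longleftrightarrow> Ap \<in> extensional (Ob2 CC) \<and> (\<forall>B \<in> Ob2 CC.
     Ap B \<in> Hom (fprod CC (ft B) (PiF B) (ft (ft B))) B \<and> mor_over CC (ft B) (Ap B) \<and>
     (\<forall>G'. \<forall>f \<in> Hom G' (ft (ft B)). pb_mor CC f (Ap B) = Ap (pb_ext CC f B)) \<and>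
     bij_betw (\<lambda>s. pb_mor CC (pr (ft B)) s \<odot> Ap B) (bdry_fiber CC (PiF B)) (bdry_fiber CC B))"
  by (simp add: AllAp1_def Let_def)

lemma AllAp2_iff:
  "Ap \<in> AllAp2 CC PiF \<longleftrightarrow> Ap \<in> extensional (Ob2 CC) \<and> (\<forall>B \<in> Ob2 CC.
     Ap B \<in> Hom (fprod CC (PiF B) (ft B) (ft (ft B))) B \<and>
     Ap B \<odot> pr B = q_ext CC (pr (PiF B)) (ft B) \<and>
     (\<forall>G'. \<forall>f \<in> Hom G' (ft (ft B)). pb_mor CC f (Ap B) = Ap (pb_ext CC f B)) \<and>
     bij_betw (\<lambda>s. q_ext CC s (fprod CC (PiF B) (ft B) (ft (ft B))) \<odot> Ap B)
       (bdry_fiber CC (PiF B)) (bdry_fiber CC B))"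
  by (simp add: AllAp2_def Let_def)

lemma Ap2_to_Ap1_mem:
  assumes Ap: "Ap \<in> AllAp2 CC PiF"
  shows "Ap2_to_Ap1 CC PiF Ap \<in> AllAp1 CC PiF"
  unfolding AllAp1_iff
proof (intro conjI ballI allI)
  show "Ap2_to_Ap1 CC PiF Ap \<in> extensional (Ob2 CC)"
    by (simp add: Ap2_to_Ap1_def)
next
  fix B assume B: "B \<in> Ob2 CC"
  interpret S: sibling_objects CC "ft B" "PiF B" "ft (ft B)"
    using siblings[OF B] .
  have a: "Ap B \<in> Hom (fprod CC (PiF B) (ft B) (ft (ft B))) B"
      "Ap B \<odot> pr B = q_ext CC (pr (PiF B)) (ft B)"
    and nat: "\<And>G' f. f \<in> Hom G' (ft (ft B)) \<Longrightarrow> pb_mor CC f (Ap B) = Ap (pb_ext CC f B)"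
    and bij: "bij_betw (\<lambda>s. q_ext CC s (fprod CC (PiF B) (ft B) (ft (ft B))) \<odot> Ap B)
       (bdry_fiber CC (PiF B)) (bdry_fiber CC B)"
    using Ap B unfolding AllAp2_iff by blast+
  note E = exch_mor_over_ft[OF B a]
  have e: "Ap2_to_Ap1 CC PiF Ap B = exch CC (ft B) (PiF B) (ft (ft B)) \<odot> Ap B"
    using B by (simp add: Ap2_to_Ap1_def)
  show "Ap2_to_Ap1 CC PiF Ap B \<in> Hom (fprod CC (ft B) (PiF B) (ft (ft B))) B"
    "mor_over CC (ft B) (Ap2_to_Ap1 CC PiF Ap B)"
    using E e by simp_all
  show "pb_mor CC f (Ap2_to_Ap1 CC PiF Ap B) = Ap2_to_Ap1 CC PiF Ap (pb_ext CC f B)"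
    if f: "f \<in> Hom G' (ft (ft B))" for G' f
    using S.pb_mor_exch_cmp[OF a(1) E(3) f] nat[OF f] e Ob2_pb[OF B f] Pi_pb_one_step[OF B f]
    by (simp add: Ap2_to_Ap1_def)
  have "pb_mor CC (pr (ft B)) s \<odot> Ap2_to_Ap1 CC PiF Ap B =
      q_ext CC s (fprod CC (PiF B) (ft B) (ft (ft B))) \<odot> Ap B"
    if s: "s \<in> bdry_fiber CC (PiF B)" for s
    using cmp_assoc[OF S.section_exch(1)[OF s] S.exch_Hom a(1)] S.section_exch(3)[OF s] e by simp
  then show "bij_betw (\<lambda>s. pb_mor CC (pr (ft B)) s \<odot> Ap2_to_Ap1 CC PiF Ap B)
      (bdry_fiber CC (PiF B)) (bdry_fiber CC B)"
    using bij by (simp cong: bij_betw_cong)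
qed

lemma Ap1_to_Ap2_mem:
  assumes Ap: "Ap \<in> AllAp1 CC PiF"
  shows "Ap1_to_Ap2 CC PiF Ap \<in> AllAp2 CC PiF"
  unfolding AllAp2_iff
proof (intro conjI ballI allI)
  show "Ap1_to_Ap2 CC PiF Ap \<in> extensional (Ob2 CC)"
    by (simp add: Ap1_to_Ap2_def)
next
  fix B assume B: "B \<in> Ob2 CC"
  interpret S: sibling_objects CC "ft B" "PiF B" "ft (ft B)"
    using siblings[OF B] .
  interpret T: sibling_objects CC "PiF B" "ft B" "ft (ft B)"
    using S.swap .
  have a: "Ap B \<in> Hom (fprod CC (ft B) (PiF B) (ft (ft B))) B" "mor_over CC (ft B) (Ap B)"
    and nat: "\<And>G' f. f \<in> Hom G' (ft (ft B)) \<Longrightarrow> pb_mor CC f (Ap B) = Ap (pb_ext CC f B)"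
    and bij: "bij_betw (\<lambda>s. pb_mor CC (pr (ft B)) s \<odot> Ap B)
       (bdry_fiber CC (PiF B)) (bdry_fiber CC B)"
    using Ap B unfolding AllAp1_iff by blast+
  note E = exch_projection[OF B a]
  have e: "Ap1_to_Ap2 CC PiF Ap B = exch CC (PiF B) (ft B) (ft (ft B)) \<odot> Ap B"
    using B by (simp add: Ap1_to_Ap2_def)
  show "Ap1_to_Ap2 CC PiF Ap B \<in> Hom (fprod CC (PiF B) (ft B) (ft (ft B))) B"
    "Ap1_to_Ap2 CC PiF Ap B \<odot> pr B = q_ext CC (pr (PiF B)) (ft B)"
    using E e by simp_all
  show "pb_mor CC f (Ap1_to_Ap2 CC PiF Ap B) = Ap1_to_Ap2 CC PiF Ap (pb_ext CC f B)"
    if f: "f \<in> Hom G' (ft (ft B))" for G' f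
    using T.pb_mor_exch_cmp[OF a(1) E(3) f] nat[OF f] e Ob2_pb[OF B f] Pi_pb_one_step[OF B f]
    by (simp add: Ap1_to_Ap2_def)
  have "q_ext CC s (fprod CC (PiF B) (ft B) (ft (ft B))) \<odot> Ap1_to_Ap2 CC PiF Ap B =
      pb_mor CC (pr (ft B)) s \<odot> Ap B"
    if s: "s \<in> bdry_fiber CC (PiF B)" for s
    using cmp_assoc[OF S.section_exch(1)[OF s] S.exch_Hom E(1)] S.section_exch(3)[OF s] e
      S.exch_exch_cmp[OF a(1)] by simp
  then show "bij_betw (\<lambda>s. q_ext CC s (fprod CC (PiF B) (ft B) (ft (ft B))) \<odot>
      Ap1_to_Ap2 CC PiF Ap B) (bdry_fiber CC (PiF B)) (bdry_fiber CC B)"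
    using bij by (simp cong: bij_betw_cong)
qed

lemma Ap1_to_Ap2_to_Ap1:
  assumes Ap: "Ap \<in> AllAp1 CC PiF"
  shows "Ap2_to_Ap1 CC PiF (Ap1_to_Ap2 CC PiF Ap) = Ap"
proof (rule extensionalityI[of _ "Ob2 CC"])
  show "Ap2_to_Ap1 CC PiF (Ap1_to_Ap2 CC PiF Ap) \<in> extensional (Ob2 CC)" "Ap \<in> extensional (Ob2 CC)"
    using Ap by (simp_all add: Ap2_to_Ap1_def AllAp1_iff)
  fix B assume B: "B \<in> Ob2 CC"
  then show "Ap2_to_Ap1 CC PiF (Ap1_to_Ap2 CC PiF Ap) B = Ap B"
    using Ap sibling_objects.exch_exch_cmp[OF siblings[OF B], of "Ap B" B]
    by (simp add: Ap2_to_Ap1_def Ap1_to_Ap2_def AllAp1_iff)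
qed

lemma Ap2_to_Ap1_to_Ap2:
  assumes Ap: "Ap \<in> AllAp2 CC PiF"
  shows "Ap1_to_Ap2 CC PiF (Ap2_to_Ap1 CC PiF Ap) = Ap"
proof (rule extensionalityI[of _ "Ob2 CC"])
  show "Ap1_to_Ap2 CC PiF (Ap2_to_Ap1 CC PiF Ap) \<in> extensional (Ob2 CC)" "Ap \<in> extensional (Ob2 CC)"
    using Ap by (simp_all add: Ap1_to_Ap2_def AllAp2_iff)
  fix B assume B: "B \<in> Ob2 CC"
  then show "Ap1_to_Ap2 CC PiF (Ap2_to_Ap1 CC PiF Ap) B = Ap B"
    using Ap sibling_objects.exch_exch_cmp[OF sibling_objects.swap[OF siblings[OF B]], of "Ap B" B]
    by (simp add: Ap2_to_Ap1_def Ap1_to_Ap2_def AllAp2_iff)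
qed

end

theorem mainTheorem6:
  fixes CC :: "('o, 'm) csystem"  (structure)
    and PiF :: "'o \<Rightarrow> 'o"
  assumes "c_system CC"
    and "\<And>B. B \<in> Ob2 CC \<Longrightarrow> PiF B \<in> Ob"
    and "\<And>B. B \<in> Ob2 CC \<Longrightarrow> ft (PiF B) = ft (ft B)"
    and "\<And>B \<Gamma>' f. \<lbrakk>B \<in> Ob2 CC; f \<in> Hom \<Gamma>' (ft (ft B))\<rbrakk> \<Longrightarrow>
           pb_ext CC f (PiF B) = PiF (pb_ext CC f B)"
  shows "(Ap2_to_Ap1 CC PiF \<in> AllAp2 CC PiF \<rightarrow> AllAp1 CC PiF) \<and>
         (Ap1_to_Ap2 CC PiF \<in> AllAp1 CC PiF \<rightarrow> AllAp2 CC PiF) \<and>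
         (\<forall>Ap \<in> AllAp2 CC PiF. Ap1_to_Ap2 CC PiF (Ap2_to_Ap1 CC PiF Ap) = Ap) \<and>
         (\<forall>Ap \<in> AllAp1 CC PiF. Ap2_to_Ap1 CC PiF (Ap1_to_Ap2 CC PiF Ap) = Ap) \<and>
         (bij_betw (Ap2_to_Ap1 CC PiF) (AllAp2 CC PiF) (AllAp1 CC PiF))"
proof -
  interpret pi_family CC PiF
    using assms by (simp add: pi_family_def pi_family_axioms_def)
  have "bij_betw (Ap2_to_Ap1 CC PiF) (AllAp2 CC PiF) (AllAp1 CC PiF)"
    by (rule bij_betw_byWitness[where f' = "Ap1_to_Ap2 CC PiF"])
      (auto simp: Ap2_to_Ap1_mem Ap1_to_Ap2_mem Ap1_to_Ap2_to_Ap1 Ap2_to_Ap1_to_Ap2)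
  then show ?thesis
    using Ap2_to_Ap1_mem Ap1_to_Ap2_mem Ap1_to_Ap2_to_Ap1 Ap2_to_Ap1_to_Ap2 by blast
qed

end
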